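(* Let $N>0$ and let $L\ge2$ be an integer. Then the $(N,L-1)$-list-decoding capacity satisfies $$C_{L-1}(N)\;\ge\;\frac12\ln\frac{L-1}{2\pi e N L}-\frac{\ln L}{2(L-1)}.$$
   Context: A set $\mathcal{C}\subseteq\mathbb{R}^n$ is an $(N,L-1)$-multiple packing (an $(N,L-1)$-list-decodable code) if every $y\in\mathbb{R}^n$ is within Euclidean distance $\sqrt{nN}$ of at most $L-1$ points of $\mathcal{C}$; equivalently, every $L$-element subset of $\mathcal{C}$ has smallest enclosing ball of squared radius larger than $nN$. The rate (normalized logarithmic density) of $\mathcal{C}\subseteq\mathbb{R}^n$ is $$R(\mathcal{C})=\limsup_{K\to\infty}\frac1n\ln\frac{|\mathcal{C}\cap K\mathcal{B}|}{|K\mathcal{B}|},$$ where $\mathcal{B}\subset\mathbb{R}^n$ is an arbitrary centrally symmetric connected compact set with nonempty interior (e.g. the unit ball or the cube $[-1,1]^n$), $|\mathcal{C}\cap K\mathcal{B}|$ is a cardinality and $|K\mathcal{B}|$ is Lebesgue volume. The rate may be negative. The $(N,L-1)$-list-decoding capacity is $$C_{L-1}(N)=\limsup_{n\to\infty}\ \sup\{R(\mathcal{C}):\ \mathcal{C}\subseteq\mathbb{R}^n \text{ is an } (N,L-1)\text{-multiple packing}\}.$$ *)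

theory Defs
  imports "HOL-Analysis.Analysis"
begin

text \<open>
  The dimension varies inside the capacity, so the real Euclidean space of dimension \<open>n\<close> is
  rendered by functions of type \<open>nat \<Rightarrow> real\<close> that are extensional on \<open>{..<n}\<close>. This carrier is both
  the topspace of the library product topology and the space of the library product measure.
\<close>

definition Rn :: "nat \<Rightarrow> (nat \<Rightarrow> real) set" where
  "Rn n = (\<Pi>\<^sub>E i\<in>{..<n}. UNIV)"

definition Rn_topology :: "nat \<Rightarrow> (nat \<Rightarrow> real) topology" where
  "Rn_topology n = product_topology (\<lambda>_. euclideanreal) {..<n}"

definition Rn_lborel :: "nat \<Rightarrow> (nat \<Rightarrow> real) measure" where
  "Rn_lborel n = (\<Pi>\<^sub>M i\<in>{..<n}. lborel)"

definition Rn_dist :: "nat \<Rightarrow> (nat \<Rightarrow> real) \<Rightarrow> (nat \<Rightarrow> real) \<Rightarrow> real" where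
  "Rn_dist n x y = L2_set (\<lambda>i. x i - y i) {..<n}"

definition Rn_scale :: "nat \<Rightarrow> real \<Rightarrow> (nat \<Rightarrow> real) \<Rightarrow> (nat \<Rightarrow> real)" where
  "Rn_scale n c x = (\<lambda>i\<in>{..<n}. c * x i)"

lemma topspace_Rn_topology: "topspace (Rn_topology n) = Rn n"
  by (simp add: Rn_topology_def Rn_def)

lemma space_Rn_lborel: "space (Rn_lborel n) = Rn n"
  by (simp add: Rn_lborel_def Rn_def space_PiM)

text \<open>The admissible bodies in the definition of the rate; \<open>compactin\<close> includes \<open>B \<subseteq> Rn n\<close>.\<close>

definition admissible_body :: "nat \<Rightarrow> (nat \<Rightarrow> real) set \<Rightarrow> bool" where
  "admissible_body n B \<longleftrightarrow>
     compactin (Rn_topology n) B \<and>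
     connectedin (Rn_topology n) B \<and>
     Rn_topology n interior_of B \<noteq> {} \<and>
     (\<forall>x\<in>B. Rn_scale n (-1) x \<in> B)"

text \<open>Finiteness is demanded explicitly because \<open>card\<close> is \<open>0\<close> on infinite sets.\<close>

definition multiple_packing :: "nat \<Rightarrow> real \<Rightarrow> nat \<Rightarrow> (nat \<Rightarrow> real) set \<Rightarrow> bool" where
  "multiple_packing n N M \<C> \<longleftrightarrow>
     \<C> \<subseteq> Rn n \<and>
     (\<forall>y\<in>Rn n. finite {x\<in>\<C>. Rn_dist n x y \<le> sqrt (real n * N)} \<and>
                card {x\<in>\<C>. Rn_dist n x y \<le> sqrt (real n * N)} \<le> M)"

text \<open>
  The logarithm with \<open>ln 0 = -\<infinity>\<close> and \<open>ln \<infinity> = \<infinity>\<close>; the library function \<open>ln\<close> on \<open>real\<close> has \<open>ln 0 = 0\<close>,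
  which would be wrong for bodies that contain no code point.
\<close>

definition eln :: "ennreal \<Rightarrow> ereal" where
  "eln t = (if t = 0 then -\<infinity> else if t = \<infinity> then \<infinity> else ereal (ln (enn2real t)))"

text \<open>The counting measure gives the cardinality, with value \<open>\<infinity>\<close> on infinite sets.\<close>

definition rate :: "nat \<Rightarrow> (nat \<Rightarrow> real) set \<Rightarrow> (nat \<Rightarrow> real) set \<Rightarrow> ereal" where
  "rate n B \<C> =
     Limsup at_top (\<lambda>K::real.
       ereal (1 / real n) *
       eln (emeasure (count_space UNIV) (\<C> \<inter> Rn_scale n K ` B) /
            emeasure (Rn_lborel n) (Rn_scale n K ` B)))"

text \<open>The argument \<open>B\<close> fixes, for every dimension, the body with respect to which rates are taken.\<close>

definition list_decoding_capacity :: "(nat \<Rightarrow> (nat \<Rightarrow> real) set) \<Rightarrow> nat \<Rightarrow> real \<Rightarrow> ereal" where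
  "list_decoding_capacity B M N =
     limsup (\<lambda>n. SUP \<C>\<in>{\<C>. multiple_packing n N M \<C>}. rate n (B n) \<C>)"

end

theory Submission
  imports Defs "HOL-Probability.Probability"
begin

text \<open>
  The proof is random coding with expurgation. Take a region \<open>A\<close> of large volume \<open>a\<close> and about
  \<open>\<delta> a\<close> independent uniform points in it. An \<open>L\<close>-subset is bad if it fits in a ball of radius
  \<open>sqrt (n N)\<close>. If the expected number of bad subsets is small compared with the number of points,
  deleting one point from each leaves a code of density of order \<open>\<delta>\<close> without bad subsets.

  The probability of being bad is controlled through the average radius, which never exceeds the
  radius of the smallest enclosing ball, and the volume of the tuples of small average radius is
  estimated by a Gaussian integral. Rather than diagonalising the quadratic form of the average radius,
  write \<open>exp (- s |x - y|\<^sup>2)\<close> for the kernel at \<open>x\<close> and integrate the product of the \<open>L\<close> kernels over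
  a common variable \<open>y\<close>. A bad tuple has energy at least
  \<open>exp (- s L n N) (pi / (s L)) powr (n / 2)\<close> (\<open>gauss_energy_ge\<close>), whereas independence and Fubini bound
  the mean energy by \<open>(pi / s) powr (n L / 2) / a ^ (L - 1)\<close> (\<open>nn_integral_gauss_energy_le\<close>). The
  quotient is \<open>w ^ n / a ^ (L - 1)\<close>, so densities \<open>\<delta>\<close> with \<open>\<delta> ^ (L - 1)\<close> of order \<open>w ^ (- n)\<close> are
  attained (\<open>finite_code_in_region\<close>). Optimising over \<open>s\<close> turns \<open>- ln w / (L - 1)\<close> into the claimed
  bound.

  For an infinite constellation, finite codes of this kind are put into the dilates \<open>K B\<close> of the body
  for a rapidly increasing sequence of \<open>K\<close>, each outside a cube around the previous ones
  (\<open>finite_code_far_out\<close>, \<open>multiple_packing_of_finite_codes\<close>). The removed cube takes at most half of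
  the volume of \<open>K B\<close>, so the density at these scales is of order \<open>\<delta>\<close>. This suffices because the rate
  is an upper limit over \<open>K\<close>. The constant factors lost on the way disappear as \<open>n\<close> tends to infinity.
\<close>

section \<open>The Gaussian energy of a tuple of points\<close>

definition gauss_kernel :: "nat \<Rightarrow> real \<Rightarrow> (nat \<Rightarrow> real) \<Rightarrow> (nat \<Rightarrow> real) \<Rightarrow> real" where
  "gauss_kernel n s x y = exp (- s * (\<Sum>i<n. (x i - y i)\<^sup>2))"

lemma gauss_kernel_commute: "gauss_kernel n s x y = gauss_kernel n s y x"
  unfolding gauss_kernel_def by (simp add: power2_commute)

lemma gauss_kernel_nonneg [simp]: "0 \<le> gauss_kernel n s x y"
  by (simp add: gauss_kernel_def)

lemma sigma_finite_Rn_lborel: "sigma_finite_measure (Rn_lborel n)"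
proof -
  interpret finite_product_sigma_finite "\<lambda>_::nat. lborel::real measure" "{..<n}"
    by unfold_locales auto
  show ?thesis unfolding Rn_lborel_def by unfold_locales
qed

lemma measurable_gauss_kernel [measurable]:
  assumes "f \<in> measurable M (Rn_lborel n)" "g \<in> measurable M (Rn_lborel n)"
  shows "(\<lambda>w. gauss_kernel n s (f w) (g w)) \<in> borel_measurable M"
proof -
  have c: "(\<lambda>w. h w i) \<in> borel_measurable M"
    if "h \<in> measurable M (Rn_lborel n)" "i < n" for h i
  proof -
    have "(\<lambda>x. x i) \<in> measurable (Rn_lborel n) lborel"
      unfolding Rn_lborel_def using that by (intro measurable_component_singleton) auto
    from measurable_compose[OF that(1) this] show ?thesis by simp
  qed
  show ?thesis
    unfolding gauss_kernel_def
    by (intro borel_measurable_exp measurable_compose[OF _ borel_measurable_exp]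
        borel_measurable_times borel_measurable_const borel_measurable_sum
        borel_measurable_power borel_measurable_diff c assms) auto
qed

lemma nn_integral_gauss:
  fixes a s :: real
  assumes "s > 0"
  shows "(\<integral>\<^sup>+t. ennreal (exp (- s * (t - a)\<^sup>2)) \<partial>lborel) = ennreal (sqrt (pi / s))"
proof -
  define \<sigma> where "\<sigma> = 1 / sqrt (2 * s)"
  have s2: "\<sigma>\<^sup>2 = 1 / (2 * s)" using assms by (simp add: \<sigma>_def power_divide)
  have eq: "exp (- s * (t - a)\<^sup>2) = sqrt (pi / s) * normal_density a \<sigma> t" for t
    using assms by (simp add: normal_density_def s2 field_simps real_sqrt_divide)
  have pos: "\<sigma> > 0" using assms by (simp add: \<sigma>_def)
  have "(\<integral>\<^sup>+t. ennreal (normal_density a \<sigma> t) \<partial>lborel) = 1"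
    using pos by (subst nn_integral_eq_integral) auto
  then show ?thesis
    unfolding eq using assms by (simp add: ennreal_mult nn_integral_cmult)
qed

lemma nn_integral_gauss_kernel:
  assumes "s > 0"
  shows "(\<integral>\<^sup>+x. ennreal (gauss_kernel n s x y) \<partial>Rn_lborel n) = ennreal (sqrt (pi / s) ^ n)"
proof -
  interpret product_sigma_finite "\<lambda>_::nat. lborel::real measure" by unfold_locales
  have "ennreal (gauss_kernel n s x y) = (\<Prod>i<n. ennreal (exp (- s * (x i - y i)\<^sup>2)))" for x
    by (simp add: gauss_kernel_def prod_ennreal sum_distrib_left exp_sum flip: sum_negf)
  then have "(\<integral>\<^sup>+x. ennreal (gauss_kernel n s x y) \<partial>Rn_lborel n)
     = (\<Prod>i<n. \<integral>\<^sup>+t. ennreal (exp (- s * (t - y i)\<^sup>2)) \<partial>lborel)"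
    unfolding Rn_lborel_def by (simp only:) (rule product_nn_integral_prod, auto)
  also have "\<dots> = ennreal (sqrt (pi / s)) ^ n"
    by (simp only: nn_integral_gauss[OF assms] prod_constant card_lessThan)
  finally show ?thesis using assms by (simp add: ennreal_power)
qed

text \<open>The sum of squared distances to \<open>y\<close> is the sum of squared distances to the barycentre plus
  \<open>card S\<close> times the squared distance from the barycentre to \<open>y\<close>, and the first of these
  two terms only increases when the barycentre is replaced in it by another centre \<open>z\<close>.\<close>

lemma sum_squares_le_barycentre:
  fixes f :: "'a \<Rightarrow> real"
  assumes "finite S" "S \<noteq> {}"
  shows "(\<Sum>k\<in>S. (f k - y)\<^sup>2)
    \<le> (\<Sum>k\<in>S. (f k - z)\<^sup>2) + real (card S) * ((\<Sum>k\<in>S. f k) / real (card S) - y)\<^sup>2"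
proof -
  define l where "l = real (card S)"
  define m where "m = (\<Sum>k\<in>S. f k) / l"
  have l: "l > 0" using assms by (simp add: l_def card_gt_0_iff)
  have sf: "(\<Sum>k\<in>S. f k) = l * m" using l by (simp add: m_def)
  have e: "(\<Sum>k\<in>S. (f k - u)\<^sup>2) = (\<Sum>k\<in>S. (f k)\<^sup>2) - 2 * u * (l * m) + l * u\<^sup>2" for u
  proof -
    have "(\<Sum>k\<in>S. (f k - u)\<^sup>2) = (\<Sum>k\<in>S. (f k)\<^sup>2 - 2 * u * f k + u\<^sup>2)"
      by (intro sum.cong) (simp_all add: power2_diff)
    also have "\<dots> = (\<Sum>k\<in>S. (f k)\<^sup>2) - 2 * u * (\<Sum>k\<in>S. f k) + l * u\<^sup>2"
      by (simp add: sum.distrib sum_subtractf sum_distrib_left l_def)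
    finally show ?thesis unfolding sf .
  qed
  have "0 \<le> l * (z - m)\<^sup>2" using l by simp
  then show ?thesis
    unfolding e m_def[symmetric] l_def[symmetric]
    by (simp add: power2_eq_square algebra_simps)
qed

lemma Rn_dist_sq: "(Rn_dist n x y)\<^sup>2 = (\<Sum>i<n. (x i - y i)\<^sup>2)"
  by (simp add: Rn_dist_def L2_set_def sum_nonneg)

text \<open>The energy of a tuple is the integral over \<open>y\<close> of the product of the kernels centred at its
  points. A tuple lying in a ball of radius \<open>r\<close> has large energy: by the barycentre inequality the
  product of the kernels is at least \<open>exp (- s L r\<^sup>2)\<close> times a single Gaussian of parameter \<open>s L\<close>
  centred at the barycentre \<open>c\<close>, whose integral is explicit. The energy thus serves as a smooth
  majorant of the indicator of the tuples that violate list decodability.\<close>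

lemma gauss_energy_ge:
  assumes S: "finite S" "card S = L" "L > 0" and s: "s > 0"
    and near: "\<And>k. k \<in> S \<Longrightarrow> Rn_dist n (x k) z \<le> r"
  shows "ennreal (exp (- s * (L * r\<^sup>2)) * sqrt (pi / (s * L)) ^ n)
    \<le> (\<integral>\<^sup>+y. (\<Prod>k\<in>S. ennreal (gauss_kernel n s (x k) y)) \<partial>Rn_lborel n)"
proof -
  define c where "c = (\<lambda>i\<in>{..<n}. (\<Sum>k\<in>S. x k i) / L)"
  have c: "c \<in> space (Rn_lborel n)" by (simp add: c_def space_Rn_lborel Rn_def)
  have ne: "S \<noteq> {}" using S by auto
  have le: "exp (- s * (L * r\<^sup>2)) * gauss_kernel n (s * L) y c \<le> (\<Prod>k\<in>S. gauss_kernel n s (x k) y)" for y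
  proof -
    have "(\<Sum>k\<in>S. \<Sum>i<n. (x k i - y i)\<^sup>2) = (\<Sum>i<n. \<Sum>k\<in>S. (x k i - y i)\<^sup>2)"
      by (rule sum.swap)
    also have "\<dots> \<le> (\<Sum>i<n. (\<Sum>k\<in>S. (x k i - z i)\<^sup>2) + L * (c i - y i)\<^sup>2)"
    proof (intro sum_mono)
      fix i assume "i \<in> {..<n}"
      then show "(\<Sum>k\<in>S. (x k i - y i)\<^sup>2) \<le> (\<Sum>k\<in>S. (x k i - z i)\<^sup>2) + L * (c i - y i)\<^sup>2"
        using sum_squares_le_barycentre[OF S(1) ne, of "\<lambda>k. x k i" "y i" "z i"] S(2)
        by (simp add: c_def)
    qed
    also have "\<dots> = (\<Sum>k\<in>S. (Rn_dist n (x k) z)\<^sup>2) + L * (\<Sum>i<n. (c i - y i)\<^sup>2)"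
      by (simp add: sum.distrib sum_distrib_left Rn_dist_sq, rule sum.swap)
    also have "(\<Sum>k\<in>S. (Rn_dist n (x k) z)\<^sup>2) \<le> (\<Sum>k\<in>S. r\<^sup>2)"
      by (intro sum_mono power_mono near) (auto simp: Rn_dist_def L2_set_nonneg)
    also have "\<dots> = L * r\<^sup>2" using S by simp
    finally have "s * (\<Sum>k\<in>S. \<Sum>i<n. (x k i - y i)\<^sup>2)
        \<le> s * (L * r\<^sup>2 + L * (\<Sum>i<n. (c i - y i)\<^sup>2))"
      using s by (intro mult_left_mono) auto
    moreover have "(\<Prod>k\<in>S. gauss_kernel n s (x k) y) = exp (- (s * (\<Sum>k\<in>S. \<Sum>i<n. (x k i - y i)\<^sup>2)))"
      unfolding gauss_kernel_def
      by (simp add: exp_sum[OF S(1)] sum_distrib_left flip: sum_negf)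
    ultimately show ?thesis
      by (simp add: gauss_kernel_def power2_commute[of "y _"] algebra_simps flip: exp_add)
  qed
  have "ennreal (exp (- s * (L * r\<^sup>2)) * sqrt (pi / (s * L)) ^ n)
      = (\<integral>\<^sup>+y. ennreal (exp (- s * (L * r\<^sup>2)) * gauss_kernel n (s * L) y c) \<partial>Rn_lborel n)"
    using s S(3) c by (simp add: ennreal_mult nn_integral_gauss_kernel nn_integral_cmult
        measurable_gauss_kernel)
  also have "\<dots> \<le> (\<integral>\<^sup>+y. (\<Prod>k\<in>S. ennreal (gauss_kernel n s (x k) y)) \<partial>Rn_lborel n)"
    using le by (intro nn_integral_mono) (simp add: prod_ennreal ennreal_leI)
  finally show ?thesis .
qed

text \<open>For a fixed \<open>y\<close> independence makes the expected product of kernels equal to \<open>p y ^ L\<close>, where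
  \<open>p y\<close> is the mean of one kernel. Dropping the restriction to \<open>A\<close> bounds \<open>p\<close> pointwise by
  \<open>sqrt (pi / s) ^ n / a\<close>, while Fubini shows that its integral over \<open>y\<close> is exactly
  \<open>sqrt (pi / s) ^ n\<close>. So only \<open>L - 1\<close> of the \<open>L\<close> factors contribute a \<open>1 / a\<close>; the exponent \<open>L - 1\<close>
  is what makes a positive density possible.\<close>

lemma nn_integral_gauss_energy_le:
  fixes M :: nat
  assumes A: "A \<in> sets (Rn_lborel n)" "emeasure (Rn_lborel n) A = ennreal a" "a > 0"
    and S: "S \<subseteq> {..<M}" "card S = L" "L > 0" and s: "s > 0"
  shows "(\<integral>\<^sup>+\<omega>. (\<integral>\<^sup>+y. (\<Prod>k\<in>S. ennreal (gauss_kernel n s (\<omega> k) y)) \<partial>Rn_lborel n)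
      \<partial>(\<Pi>\<^sub>M i\<in>{..<M}. uniform_measure (Rn_lborel n) A))
    \<le> ennreal (sqrt (pi / s) ^ (n * L) / a ^ (L - 1))"
proof -
  define U where "U = uniform_measure (Rn_lborel n) A"
  define p where "p = (\<lambda>y. (\<integral>\<^sup>+x. ennreal (gauss_kernel n s x y) \<partial>U))"
  define g where "g = sqrt (pi / s) ^ n"
  have g: "g \<ge> 0" using s by (simp add: g_def)
  have sU [simp, measurable_cong]: "sets U = sets (Rn_lborel n)" by (simp add: U_def)
  interpret U: prob_space U unfolding U_def using A by (intro prob_space_uniform_measure) auto
  interpret PU: product_prob_space "\<lambda>_::nat. U" by unfold_locales
  interpret R: sigma_finite_measure "Rn_lborel n" by (rule sigma_finite_Rn_lborel)
  interpret P: prob_space "\<Pi>\<^sub>M i\<in>{..<M}. U" by (rule prob_space_PiM) unfold_locales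
  interpret PR: pair_sigma_finite "\<Pi>\<^sub>M i\<in>{..<M}. U" "Rn_lborel n" by unfold_locales
  have comp: "(\<lambda>\<omega>. \<omega> k) \<in> measurable (\<Pi>\<^sub>M i\<in>{..<M}. U) (Rn_lborel n)" if "k \<in> S" for k
  proof -
    have "(\<lambda>\<omega>. \<omega> k) \<in> measurable (\<Pi>\<^sub>M i\<in>{..<M}. U) U"
      using that S by (intro measurable_component_singleton) auto
    then show ?thesis unfolding measurable_cong_sets[OF refl sU] .
  qed
  have meas: "(\<lambda>(\<omega>, y). \<Prod>k\<in>S. ennreal (gauss_kernel n s (\<omega> k) y))
      \<in> borel_measurable ((\<Pi>\<^sub>M i\<in>{..<M}. U) \<Otimes>\<^sub>M Rn_lborel n)"
    unfolding case_prod_beta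
    by (intro borel_measurable_prod_ennreal measurable_compose[OF _ measurable_ennreal]
        measurable_gauss_kernel measurable_snd measurable_compose[OF measurable_fst comp])
  have mg: "(\<lambda>x. ennreal (gauss_kernel n s x y)) \<in> borel_measurable (Rn_lborel n)"
    if "y \<in> space (Rn_lborel n)" for y
    using that by measurable
  \<comment> \<open>The product over \<open>S\<close> is padded with ones to a product over all coordinates of the sample.\<close>
  have prod: "(\<integral>\<^sup>+\<omega>. (\<Prod>k\<in>S. ennreal (gauss_kernel n s (\<omega> k) y)) \<partial>(\<Pi>\<^sub>M i\<in>{..<M}. U)) = p y ^ L"
    if y: "y \<in> space (Rn_lborel n)" for y
  proof -
    have "(\<integral>\<^sup>+\<omega>. (\<Prod>k\<in>S. ennreal (gauss_kernel n s (\<omega> k) y)) \<partial>(\<Pi>\<^sub>M i\<in>{..<M}. U))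
      = (\<integral>\<^sup>+\<omega>. (\<Prod>k\<in>{..<M}. (if k \<in> S then ennreal (gauss_kernel n s (\<omega> k) y) else 1)) \<partial>(\<Pi>\<^sub>M i\<in>{..<M}. U))"
      using S(1) by (intro nn_integral_cong) (simp add: prod.If_cases Int_absorb1)
    also have "\<dots> = (\<Prod>k\<in>{..<M}. \<integral>\<^sup>+x. (if k \<in> S then ennreal (gauss_kernel n s x y) else 1) \<partial>U)"
      using y by (intro PU.product_nn_integral_prod) auto
    also have "\<dots> = (\<Prod>k\<in>{..<M}. if k \<in> S then p y else 1)"
      by (intro prod.cong) (auto simp: p_def U.emeasure_space_1)
    also have "\<dots> = p y ^ L"
      using S by (simp add: prod.If_cases Int_absorb1)
    finally show ?thesis .
  qed
  have p_eq: "p y = (\<integral>\<^sup>+x. ennreal (gauss_kernel n s x y) * indicator A x \<partial>Rn_lborel n) / a"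
    if "y \<in> space (Rn_lborel n)" for y
    unfolding p_def U_def using A mg[OF that] by (subst nn_integral_uniform_measure) auto
  have p_le: "p y \<le> ennreal (g / a)" if y: "y \<in> space (Rn_lborel n)" for y
  proof -
    have "p y \<le> (\<integral>\<^sup>+x. ennreal (gauss_kernel n s x y) \<partial>Rn_lborel n) / a"
      unfolding p_eq[OF y] by (intro divide_right_mono_ennreal nn_integral_mono) (auto simp: indicator_def)
    also have "\<dots> = ennreal (g / a)"
      using A(3) g by (simp add: nn_integral_gauss_kernel[OF s] g_def divide_ennreal)
    finally show ?thesis .
  qed
  have mp: "p \<in> borel_measurable (Rn_lborel n)"
    unfolding p_def by (intro U.borel_measurable_nn_integral) measurable
  have int_p: "(\<integral>\<^sup>+y. p y \<partial>Rn_lborel n) = ennreal g"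
  proof -
    interpret UR: pair_sigma_finite U "Rn_lborel n" by unfold_locales
    have "(\<integral>\<^sup>+y. p y \<partial>Rn_lborel n)
      = (\<integral>\<^sup>+x. (\<integral>\<^sup>+y. ennreal (gauss_kernel n s x y) \<partial>Rn_lborel n) \<partial>U)"
      unfolding p_def by (rule UR.Fubini') measurable
    also have "\<dots> = ennreal g"
      using nn_integral_gauss_kernel[OF s, of n]
      by (subst gauss_kernel_commute) (simp add: U.emeasure_space_1 g_def)
    finally show ?thesis .
  qed
  have "(\<integral>\<^sup>+\<omega>. (\<integral>\<^sup>+y. (\<Prod>k\<in>S. ennreal (gauss_kernel n s (\<omega> k) y)) \<partial>Rn_lborel n) \<partial>(\<Pi>\<^sub>M i\<in>{..<M}. U))
    = (\<integral>\<^sup>+y. (\<integral>\<^sup>+\<omega>. (\<Prod>k\<in>S. ennreal (gauss_kernel n s (\<omega> k) y)) \<partial>(\<Pi>\<^sub>M i\<in>{..<M}. U)) \<partial>Rn_lborel n)"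
    by (rule PR.Fubini'[symmetric, OF meas])
  also have "\<dots> = (\<integral>\<^sup>+y. p y ^ L \<partial>Rn_lborel n)"
    by (intro nn_integral_cong prod)
  also have "\<dots> \<le> (\<integral>\<^sup>+y. ennreal (g / a) ^ (L - 1) * p y \<partial>Rn_lborel n)"
  proof (intro nn_integral_mono)
    fix y assume "y \<in> space (Rn_lborel n)"
    then have "p y ^ (L - 1) * p y \<le> ennreal (g / a) ^ (L - 1) * p y"
      by (intro mult_right_mono power_mono p_le) auto
    then show "p y ^ L \<le> ennreal (g / a) ^ (L - 1) * p y"
      using S(3) by (cases L) (simp_all add: mult.commute)
  qed
  also have "\<dots> = ennreal (g / a) ^ (L - 1) * ennreal g"
    using mp by (simp add: nn_integral_cmult int_p)
  also have "\<dots> = ennreal (g ^ L / a ^ (L - 1))"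
    using g A(3) S(3) by (cases L)
      (simp_all add: ennreal_power power_divide flip: ennreal_mult)
  also have "g ^ L = sqrt (pi / s) ^ (n * L)" by (simp add: g_def power_mult)
  finally show ?thesis unfolding U_def .
qed

section \<open>Random coding with expurgation\<close>

text \<open>One index is deleted from every bad index set. The points are indexed by a sequence that may take
  a value several times. Such repetitions need no separate treatment, since \<open>L\<close> equal points form a
  bad set as well: at most \<open>L - 1\<close> surviving indices share a value, which costs a factor \<open>L - 1\<close>
  that is negligible for the rate.\<close>

lemma expurgation:
  fixes X :: "nat \<Rightarrow> 'a" and L M :: nat and near :: "'a \<Rightarrow> 'a \<Rightarrow> bool"
  defines "Bad \<equiv> {S. S \<subseteq> {..<M} \<and> card S = L \<and> (\<exists>z. \<forall>k\<in>S. near (X k) z)}"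
  assumes L: "L > 0" and refl: "\<And>x. near x x"
  obtains F where "F \<subseteq> X ` {..<M}" "\<And>z. card {x\<in>F. near x z} \<le> L - 1"
    "M \<le> (L - 1) * card F + card Bad"
proof -
  have finBad: "finite Bad"
    by (rule finite_subset[of _ "Pow {..<M}"]) (auto simp: Bad_def)
  have ex: "\<exists>k. k \<in> S" if "S \<in> Bad" for S
  proof -
    have "S \<noteq> {}" using that L by (auto simp: Bad_def)
    then show ?thesis by blast
  qed
  define pick where "pick = (\<lambda>S. SOME k::nat. k \<in> S)"
  have pick: "pick S \<in> S" if "S \<in> Bad" for S
    unfolding pick_def by (rule someI_ex[OF ex[OF that]])
  define J where "J = {..<M} - pick ` Bad"
  define F where "F = X ` J"
  have finJ: "finite J" by (simp add: J_def)
  have near_J: "card {k\<in>J. near (X k) z} \<le> L - 1" for z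
  proof (rule ccontr)
    assume "\<not> ?thesis"
    then have "L \<le> card {k\<in>J. near (X k) z}" by simp
    then obtain S where S: "S \<subseteq> {k\<in>J. near (X k) z}" "card S = L"
      by (rule obtain_subset_with_card_n)
    then have "S \<in> Bad" by (auto simp: Bad_def J_def)
    with pick[of S] S(1) show False by (auto simp: J_def)
  qed
  have "card {x\<in>F. near x z} \<le> L - 1" for z
  proof -
    have "{x\<in>F. near x z} = X ` {k\<in>J. near (X k) z}" by (auto simp: F_def)
    then have "card {x\<in>F. near x z} \<le> card {k\<in>J. near (X k) z}"
      using finJ by (simp add: card_image_le)
    with near_J[of z] show ?thesis by linarith
  qed
  moreover have "M \<le> (L - 1) * card F + card Bad"
  proof -
    have "J = (\<Union>x\<in>F. {k\<in>J. X k = x})" by (auto simp: F_def)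
    then have "card J \<le> (\<Sum>x\<in>F. card {k\<in>J. X k = x})"
      using card_UN_le[of F "\<lambda>x. {k\<in>J. X k = x}"] finJ by (simp add: F_def)
    also have "\<dots> \<le> (\<Sum>x\<in>F. L - 1)"
    proof (intro sum_mono)
      fix x
      have "card {k\<in>J. X k = x} \<le> card {k\<in>J. near (X k) x}"
        using finJ refl by (intro card_mono) auto
      with near_J[of x] show "card {k\<in>J. X k = x} \<le> L - 1" by linarith
    qed
    finally have "card J \<le> (L - 1) * card F" by (simp add: mult.commute)
    moreover have "M \<le> card J + card (pick ` Bad)"
      using diff_card_le_card_Diff[of "pick ` Bad" "{..<M}"] finBad by (simp add: J_def)
    moreover have "card (pick ` Bad) \<le> card Bad" by (rule card_image_le[OF finBad])
    ultimately show ?thesis by linarith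
  qed
  moreover have "F \<subseteq> X ` {..<M}" by (auto simp: F_def J_def)
  ultimately show ?thesis using that by blast
qed

text \<open>Independent uniform points in \<open>A\<close> have mean total energy at most half the stated bound. The
  factor 2 makes the argument work with almost-everywhere comparisons: if almost all samples in \<open>A\<close>
  exceeded twice the positive, finite bound on the mean, so would the mean.\<close>

lemma low_energy_configuration:
  fixes M :: nat
  assumes A: "A \<in> sets (Rn_lborel n)" "emeasure (Rn_lborel n) A = ennreal a" "a > 0"
    and L: "L > 0" and M: "M > 0" and s: "s > 0"
  obtains X where "\<And>k. k < M \<Longrightarrow> X k \<in> A"
    "(\<Sum>S | S \<subseteq> {..<M} \<and> card S = L.
       \<integral>\<^sup>+y. (\<Prod>k\<in>S. ennreal (gauss_kernel n s (X k) y)) \<partial>Rn_lborel n)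
     \<le> ennreal (2 * (real M ^ L * (sqrt (pi / s) ^ (n * L) / a ^ (L - 1))))"
proof -
  define U where "U = uniform_measure (Rn_lborel n) A"
  define P where "P = (\<Pi>\<^sub>M i\<in>{..<M}. U)"
  define E where "E = (\<lambda>(S::nat set) X. \<integral>\<^sup>+y. (\<Prod>k\<in>S. ennreal (gauss_kernel n s (X k) y)) \<partial>Rn_lborel n)"
  define T where "T = {S. S \<subseteq> {..<M} \<and> card S = L}"
  define q where "q = sqrt (pi / s) ^ (n * L) / a ^ (L - 1)"
  have q: "q > 0" using s A(3) by (simp add: q_def)
  have sU: "sets U = sets (Rn_lborel n)" by (simp add: U_def)
  interpret U: prob_space U unfolding U_def using A by (intro prob_space_uniform_measure) auto
  interpret R: sigma_finite_measure "Rn_lborel n" by (rule sigma_finite_Rn_lborel)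
  interpret P: prob_space P unfolding P_def by (rule prob_space_PiM) unfold_locales
  have finT: "finite T" by (rule finite_subset[of _ "Pow {..<M}"]) (auto simp: T_def)
  have "card T = M choose L" unfolding T_def using n_subsets[of "{..<M}" L] by simp
  then have cT: "real (card T) \<le> real M ^ L"
    by (cases "L \<le> M") (simp_all add: binomial_le_pow binomial_eq_0 flip: of_nat_power)
  have mE: "E S \<in> borel_measurable P" if "S \<in> T" for S
  proof -
    have comp: "(\<lambda>X. X k) \<in> measurable P (Rn_lborel n)" if "k \<in> S" for k
    proof -
      have "(\<lambda>X. X k) \<in> measurable P U"
        using that \<open>S \<in> T\<close> unfolding P_def T_def by (intro measurable_component_singleton) auto
      then show ?thesis unfolding measurable_cong_sets[OF HOL.refl sU] .
    qed
    show ?thesis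
      unfolding E_def
      by (intro R.borel_measurable_nn_integral, unfold case_prod_beta)
        (intro borel_measurable_prod_ennreal measurable_compose[OF _ measurable_ennreal]
        measurable_gauss_kernel measurable_snd measurable_compose[OF measurable_fst comp])
  qed
  have "(\<integral>\<^sup>+X. (\<Sum>S\<in>T. E S X) \<partial>P) = (\<Sum>S\<in>T. \<integral>\<^sup>+X. E S X \<partial>P)"
    by (rule nn_integral_sum[OF mE])
  also have "\<dots> \<le> (\<Sum>S\<in>T. ennreal q)"
    unfolding E_def P_def U_def q_def
    by (intro sum_mono nn_integral_gauss_energy_le A L s) (auto simp: T_def)
  also have "\<dots> = ennreal (real (card T) * q)"
    using q by (simp add: ennreal_mult ennreal_of_nat_eq_real_of_nat)
  also have "\<dots> \<le> ennreal (real M ^ L * q)"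
    using q cT by (intro ennreal_leI mult_right_mono) auto
  finally have mean: "(\<integral>\<^sup>+X. (\<Sum>S\<in>T. E S X) \<partial>P) \<le> ennreal (real M ^ L * q)" .
  have AE_A: "AE X in P. \<forall>k\<in>{..<M}. X k \<in> A"
  proof (rule AE_finite_allI)
    fix k assume "k \<in> {..<M}"
    moreover have "AE x in U. x \<in> A" unfolding U_def by (rule AE_uniform_measureI) (auto simp: A)
    ultimately show "AE X in P. X k \<in> A"
      unfolding P_def by (intro AE_PiM_component) (auto intro: U.prob_space_axioms)
  qed simp
  have "\<exists>X. (\<forall>k\<in>{..<M}. X k \<in> A) \<and> (\<Sum>S\<in>T. E S X) \<le> ennreal (2 * (real M ^ L * q))"
  proof (rule ccontr)
    assume neg: "\<not> ?thesis"
    have "ennreal (2 * (real M ^ L * q)) = (\<integral>\<^sup>+X. ennreal (2 * (real M ^ L * q)) \<partial>P)"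
      by (simp add: P.emeasure_space_1)
    also have "\<dots> \<le> (\<integral>\<^sup>+X. (\<Sum>S\<in>T. E S X) \<partial>P)"
    proof (rule nn_integral_mono_AE)
      show "AE X in P. ennreal (2 * (real M ^ L * q)) \<le> (\<Sum>S\<in>T. E S X)"
        using AE_A by eventually_elim (use neg in \<open>meson linear\<close>)
    qed
    also note mean
    finally have "2 * (real M ^ L * q) \<le> real M ^ L * q"
      using q by (subst (asm) ennreal_le_iff) auto
    moreover have "real M ^ L * q > 0" using q M by simp
    ultimately show False by linarith
  qed
  then show ?thesis
    using that unfolding E_def T_def q_def by blast
qed

text \<open>Markov's inequality for counting: each bad index set contributes at least the energy of
  lemma \<open>gauss_energy_ge\<close> to the total energy, so the quotient of the two bounds limits the number of bad sets.\<close>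

lemma finite_code_in_region:
  fixes M :: nat
  assumes A: "A \<in> sets (Rn_lborel n)" "emeasure (Rn_lborel n) A = ennreal a" "a > 0"
    and L: "L > 0" and M: "M > 0" and s: "s > 0" and r: "r \<ge> 0"
  obtains F where "finite F" "F \<subseteq> A" "\<And>z. card {x\<in>F. Rn_dist n x z \<le> r} \<le> L - 1"
    "real M \<le> real (L - 1) * real (card F)
      + 2 * (real M ^ L * (sqrt (pi / s) ^ (n * L) / a ^ (L - 1)))
        / (exp (- s * (L * r\<^sup>2)) * sqrt (pi / (s * L)) ^ n)"
proof -
  define low where "low = exp (- s * (L * r\<^sup>2)) * sqrt (pi / (s * L)) ^ n"
  define up where "up = 2 * (real M ^ L * (sqrt (pi / s) ^ (n * L) / a ^ (L - 1)))"
  have low: "low > 0" using s L by (simp add: low_def)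
  have up: "up \<ge> 0" using s A by (simp add: up_def)
  obtain X where XA: "\<And>k. k < M \<Longrightarrow> X k \<in> A"
    and en: "(\<Sum>S | S \<subseteq> {..<M} \<and> card S = L.
       \<integral>\<^sup>+y. (\<Prod>k\<in>S. ennreal (gauss_kernel n s (X k) y)) \<partial>Rn_lborel n) \<le> ennreal up"
    using low_energy_configuration[OF A L M s, folded up_def] by blast
  define Bad where "Bad = {S. S \<subseteq> {..<M} \<and> card S = L \<and> (\<exists>z. \<forall>k\<in>S. Rn_dist n (X k) z \<le> r)}"
  have self: "Rn_dist n x x \<le> r" for x using r by (simp add: Rn_dist_def L2_set_def)
  have finT: "finite {S. S \<subseteq> {..<M} \<and> card S = L}"
    by (rule finite_subset[of _ "Pow {..<M}"]) auto
  obtain F where F: "F \<subseteq> X ` {..<M}" "\<And>z. card {x\<in>F. Rn_dist n x z \<le> r} \<le> L - 1"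
    "M \<le> (L - 1) * card F + card Bad"
    using expurgation[where near = "\<lambda>x z. Rn_dist n x z \<le> r" and X = X and M = M, OF L self]
    unfolding Bad_def by blast
  have "ennreal (real (card Bad) * low) = (\<Sum>S\<in>Bad. ennreal low)"
    using low by (simp add: ennreal_mult ennreal_of_nat_eq_real_of_nat)
  also have "\<dots> \<le> (\<Sum>S\<in>Bad. \<integral>\<^sup>+y. (\<Prod>k\<in>S. ennreal (gauss_kernel n s (X k) y)) \<partial>Rn_lborel n)"
  proof (intro sum_mono)
    fix S assume "S \<in> Bad"
    then obtain z where z: "S \<subseteq> {..<M}" "card S = L" "\<And>k. k \<in> S \<Longrightarrow> Rn_dist n (X k) z \<le> r"
      by (auto simp: Bad_def)
    have "finite S" by (rule finite_subset[OF z(1)]) simp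
    then show "ennreal low \<le> (\<integral>\<^sup>+y. (\<Prod>k\<in>S. ennreal (gauss_kernel n s (X k) y)) \<partial>Rn_lborel n)"
      unfolding low_def by (rule gauss_energy_ge[OF _ z(2) L s z(3)])
  qed
  also have "\<dots> \<le> (\<Sum>S | S \<subseteq> {..<M} \<and> card S = L.
       \<integral>\<^sup>+y. (\<Prod>k\<in>S. ennreal (gauss_kernel n s (X k) y)) \<partial>Rn_lborel n)"
    by (rule sum_mono2[OF finT]) (auto simp: Bad_def)
  also note en
  finally have "real (card Bad) * low \<le> up" using up by (subst (asm) ennreal_le_iff) auto
  then have bad: "real (card Bad) \<le> up / low" using low by (simp add: field_simps)
  have "real M \<le> real ((L - 1) * card F + card Bad)" using F(3) by (simp only: of_nat_le_iff)
  then have "real M \<le> real (L - 1) * real (card F) + up / low" using bad by simp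
  moreover have "finite F" by (rule finite_subset[OF F(1)]) simp
  moreover have "F \<subseteq> A" using F(1) XA by auto
  ultimately show ?thesis using that F(2) unfolding up_def low_def by blast
qed

section \<open>Volumes of dilated bodies\<close>

text \<open>Extension by zero embeds \<open>Rn n\<close> into the space of all sequences, whose Borel sets are those of
  the countable product measure. The image of a compact set is compact there, hence Borel, and the
  set is recovered as its preimage.\<close>

lemma compactin_Rn_measurable:
  assumes B: "compactin (Rn_topology n) B"
  shows "B \<in> sets (Rn_lborel n)"
proof -
  define ext where "ext = (\<lambda>(x::nat \<Rightarrow> real) i. if i < n then x i else 0)"
  have sub: "B \<subseteq> Rn n" using compactin_subset_topspace[OF B] by (simp add: topspace_Rn_topology)
  have "continuous_map (Rn_topology n) (product_topology (\<lambda>_. euclideanreal) UNIV) ext"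
    unfolding continuous_map_componentwise_UNIV ext_def Rn_topology_def
  proof
    fix k :: nat
    show "continuous_map (product_topology (\<lambda>_. euclideanreal) {..<n}) euclideanreal
        (\<lambda>x. if k < n then x k else 0)"
      by (cases "k < n") (auto intro: continuous_map_product_projection)
  qed
  from image_compactin[OF B this] have "compact (ext ` B)"
    by (simp add: euclidean_product_topology)
  then have "ext ` B \<in> sets (\<Pi>\<^sub>M i\<in>(UNIV::nat set). borel)"
    by (simp add: compact_imp_closed sets_PiM_equal_borel)
  moreover have "ext \<in> measurable (Rn_lborel n) (\<Pi>\<^sub>M i\<in>(UNIV::nat set). borel)"
    unfolding ext_def Rn_lborel_def
  proof (rule measurable_PiM_single')
    fix k :: nat
    show "(\<lambda>x. if k < n then x k else 0) \<in> borel_measurable (\<Pi>\<^sub>M i\<in>{..<n}. (lborel :: real measure))"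
      by (cases "k < n") auto
  qed auto
  ultimately have "ext -` (ext ` B) \<inter> space (Rn_lborel n) \<in> sets (Rn_lborel n)"
    by (rule measurable_sets[rotated])
  also have "ext -` (ext ` B) \<inter> space (Rn_lborel n) = B"
  proof -
    have "x = y" if "ext x = ext y" "x \<in> Rn n" "y \<in> Rn n" for x y
    proof (rule PiE_ext)
      fix i assume "i \<in> {..<n}"
      with fun_cong[OF that(1), of i] show "x i = y i" by (simp add: ext_def)
    qed (use that in \<open>auto simp: Rn_def\<close>)
    then show ?thesis using sub by (auto simp: space_Rn_lborel)
  qed
  finally show ?thesis .
qed

lemma compactin_Rn_bounded:
  assumes B: "compactin (Rn_topology n) B"
  obtains b where "b \<ge> 0" "\<And>x i. x \<in> B \<Longrightarrow> i < n \<Longrightarrow> \<bar>x i\<bar> \<le> b"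
proof -
  have "\<exists>b. \<forall>x\<in>B. \<bar>x i\<bar> \<le> b" if "i < n" for i
  proof -
    have "compactin euclideanreal ((\<lambda>x. x i) ` B)"
      using that by (intro image_compactin[OF B]) (auto simp: Rn_topology_def intro: continuous_map_product_projection)
    then have "bounded ((\<lambda>x. x i) ` B)" by (simp add: compact_imp_bounded)
    then show ?thesis by (auto simp: bounded_iff)
  qed
  then obtain b where b: "\<And>i x. i < n \<Longrightarrow> x \<in> B \<Longrightarrow> \<bar>x i\<bar> \<le> b i" by metis
  have "\<bar>x i\<bar> \<le> (\<Sum>j<n. \<bar>b j\<bar>)" if "x \<in> B" "i < n" for x i
  proof -
    have "\<bar>x i\<bar> \<le> \<bar>b i\<bar>" using b[OF that(2,1)] by linarith
    also have "\<dots> \<le> (\<Sum>j<n. \<bar>b j\<bar>)" using that by (intro member_le_sum) auto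
    finally show ?thesis .
  qed
  then show ?thesis by (intro that[of "\<Sum>j<n. \<bar>b j\<bar>"]) (auto intro: sum_nonneg)
qed

lemma compactin_Rn_scale:
  assumes B: "compactin (Rn_topology n) B"
  shows "compactin (Rn_topology n) (Rn_scale n K ` B)"
proof (rule image_compactin[OF B])
  show "continuous_map (Rn_topology n) (Rn_topology n) (Rn_scale n K)"
    unfolding Rn_topology_def continuous_map_componentwise Rn_scale_def
    by (auto intro!: continuous_map_real_mult_left continuous_map_product_projection)
qed

lemma emeasure_Rn_PiE:
  assumes "\<And>i. i < n \<Longrightarrow> A i \<in> sets borel" 
  shows "emeasure (Rn_lborel n) (\<Pi>\<^sub>E i\<in>{..<n}. A i) = (\<Prod>i<n. emeasure lborel (A i))"
proof -
  interpret product_sigma_finite "\<lambda>_::nat. lborel::real measure" by unfold_locales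
  show ?thesis unfolding Rn_lborel_def using assms by (intro emeasure_PiM) auto
qed

lemma box_measurable: "(\<Pi>\<^sub>E i\<in>{..<n}. {- R..R}) \<in> sets (Rn_lborel n)"
  unfolding Rn_lborel_def by (intro sets_PiM_I_finite) auto

lemma emeasure_box:
  assumes "R \<ge> 0"
  shows "emeasure (Rn_lborel n) (\<Pi>\<^sub>E i\<in>{..<n}. {- R..R}) = ennreal ((2 * R) ^ n)"
  using assms by (simp add: emeasure_Rn_PiE ennreal_power)

lemma interior_contains_box:
  assumes "Rn_topology n interior_of B \<noteq> {}"
  obtains x e where "e > 0" "(\<Pi>\<^sub>E i\<in>{..<n}. {x i - e<..<x i + e}) \<subseteq> B"
proof -
  obtain x where "x \<in> Rn_topology n interior_of B" using assms by auto
  moreover have "openin (Rn_topology n) (Rn_topology n interior_of B)" by simp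
  ultimately obtain U where U: "\<forall>i\<in>{..<n}. openin euclideanreal (U i)" "x \<in> Pi\<^sub>E {..<n} U"
      "Pi\<^sub>E {..<n} U \<subseteq> Rn_topology n interior_of B"
    unfolding Rn_topology_def openin_product_topology_alt by blast
  have "\<exists>e>0. \<forall>y. \<bar>y - x i\<bar> < e \<longrightarrow> y \<in> U i" if "i < n" for i
  proof -
    have "open (U i)" "x i \<in> U i" using U that by auto
    then show ?thesis by (auto simp: open_dist dist_real_def)
  qed
  then obtain e where e: "\<And>i. i < n \<Longrightarrow> e i > 0" "\<And>i y. i < n \<Longrightarrow> \<bar>y - x i\<bar> < e i \<Longrightarrow> y \<in> U i"
    by metis
  define d where "d = Min (insert 1 (e ` {..<n}))"
  have d: "d > 0" using e by (auto simp: d_def)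
  have de: "d \<le> e i" if "i < n" for i using that by (auto simp: d_def)
  have "(\<Pi>\<^sub>E i\<in>{..<n}. {x i - d<..<x i + d}) \<subseteq> Pi\<^sub>E {..<n} U"
  proof (rule PiE_mono)
    fix i assume "i \<in> {..<n}"
    then show "{x i - d<..<x i + d} \<subseteq> U i"
      using de[of i] e(2)[of i] by (auto simp: abs_less_iff)
  qed
  from subset_trans[OF this subset_trans[OF U(3) interior_of_subset]] show ?thesis
    by (rule that[OF d])
qed

text \<open>It suffices to dilate a box inside the body, so the scaling law of Lebesgue measure is needed
  for boxes only.\<close>

lemma volume_scaled_body_unbounded:
  assumes n: "n \<ge> 1" and B: "Rn_topology n interior_of B \<noteq> {}" "compactin (Rn_topology n) B"
  obtains K0 where "\<And>K. K \<ge> K0 \<Longrightarrow> ennreal V \<le> emeasure (Rn_lborel n) (Rn_scale n K ` B)"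
proof -
  obtain x e where e: "e > 0" "(\<Pi>\<^sub>E i\<in>{..<n}. {x i - e<..<x i + e}) \<subseteq> B"
    using interior_contains_box[OF B(1)] by blast
  have "ennreal V \<le> emeasure (Rn_lborel n) (Rn_scale n K ` B)"
    if K: "K \<ge> max 1 V / (2 * e)" for K
  proof -
    have K0: "K > 0" using e K by (smt (verit) divide_pos_pos)
    have K2: "max 1 V \<le> 2 * (K * e)" using e K by (simp add: field_simps)
    have sub: "(\<Pi>\<^sub>E i\<in>{..<n}. {K * x i - K * e<..<K * x i + K * e}) \<subseteq> Rn_scale n K ` B"
    proof
      fix y assume y: "y \<in> (\<Pi>\<^sub>E i\<in>{..<n}. {K * x i - K * e<..<K * x i + K * e})"
      define z where "z = Rn_scale n (1 / K) y"
      have "z \<in> (\<Pi>\<^sub>E i\<in>{..<n}. {x i - e<..<x i + e})"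
        using y K0 by (auto simp: z_def Rn_scale_def PiE_iff field_simps)
      then have "z \<in> B" using e by auto
      moreover have "Rn_scale n K z = y"
        using y K0 by (auto simp: z_def Rn_scale_def PiE_iff extensional_def)
      ultimately show "y \<in> Rn_scale n K ` B" by blast
    qed
    have "V \<le> (2 * (K * e)) ^ 1" using K2 by simp
    also have "\<dots> \<le> (2 * (K * e)) ^ n" using K2 n by (intro power_increasing) auto
    finally have "ennreal V \<le> ennreal ((2 * (K * e)) ^ n)" by (rule ennreal_leI)
    also have "\<dots> = emeasure (Rn_lborel n) (\<Pi>\<^sub>E i\<in>{..<n}. {K * x i - K * e<..<K * x i + K * e})"
      using e K0 by (simp add: emeasure_Rn_PiE ennreal_power)
    also have "\<dots> \<le> emeasure (Rn_lborel n) (Rn_scale n K ` B)"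
      by (intro emeasure_mono sub compactin_Rn_measurable compactin_Rn_scale B)
    finally show ?thesis .
  qed
  then show ?thesis by (rule that)
qed

lemma emeasure_compactin_Rn_finite:
  assumes B: "compactin (Rn_topology n) B"
  shows "emeasure (Rn_lborel n) B < \<infinity>"
proof -
  obtain b where b: "b \<ge> 0" "\<And>x i. x \<in> B \<Longrightarrow> i < n \<Longrightarrow> \<bar>x i\<bar> \<le> b"
    using compactin_Rn_bounded[OF B] by blast
  have sub: "B \<subseteq> Rn n" using compactin_subset_topspace[OF B] by (simp add: topspace_Rn_topology)
  have "B \<subseteq> (\<Pi>\<^sub>E i\<in>{..<n}. {- b..b})"
  proof (intro subsetI PiE_I)
    fix x i assume "x \<in> B" "i \<in> {..<n}"
    with b(2)[of x i] show "x i \<in> {- b..b}" by auto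
  next
    fix x i assume "x \<in> B" "i \<notin> {..<n}"
    with sub show "x i = undefined" by (auto simp: Rn_def intro: PiE_arb)
  qed
  then have "emeasure (Rn_lborel n) B \<le> emeasure (Rn_lborel n) (\<Pi>\<^sub>E i\<in>{..<n}. {- b..b})"
    by (intro emeasure_mono box_measurable)
  also have "\<dots> < \<infinity>" using b by (simp add: emeasure_box)
  finally show ?thesis .
qed

section \<open>Gluing finite codes into a constellation\<close>

text \<open>Far enough out, at least half of the volume of the dilated body lies outside any prescribed
  cube. About \<open>\<delta>\<close> times that volume many random points are placed there. The sparsity condition
  says that bad index sets then number at most half of the points. The constant 8 collects three
  halvings: from the cube, from rounding the number of points, and from the expurgation.\<close>

lemma finite_code_far_out:
  fixes r s R k \<delta> :: real
  assumes n: "n \<ge> 1" and B: "Rn_topology n interior_of B \<noteq> {}" "compactin (Rn_topology n) B"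
    and L: "L \<ge> 2" and s: "s > 0" and r: "r \<ge> 0" and R: "R \<ge> 0"
    and lam: "\<delta> > 0" and sparse: "4 * (sqrt (pi / s) ^ (n * L)
      / (exp (- s * (L * r\<^sup>2)) * sqrt (pi / (s * L)) ^ n)) * \<delta> ^ (L - 1) \<le> 1"
  obtains K F where "K \<ge> (k::real)" "finite F" "F \<subseteq> Rn_scale n K ` B"
    "\<And>x. x \<in> F \<Longrightarrow> \<exists>i<n. \<bar>x i\<bar> > R" "\<And>z. card {x\<in>F. Rn_dist n x z \<le> r} \<le> L - 1"
    "ennreal (\<delta> / (8 * real (L - 1))) * emeasure (Rn_lborel n) (Rn_scale n K ` B) \<le> of_nat (card F)"
    "0 < emeasure (Rn_lborel n) (Rn_scale n K ` B)"
proof -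
  define W where "W = sqrt (pi / s) ^ (n * L) / (exp (- s * (L * r\<^sup>2)) * sqrt (pi / (s * L)) ^ n)"
  define Q where "Q = (\<Pi>\<^sub>E i\<in>{..<n}. {- R..R})"
  have L0: "L > 0" using L by simp
  have W: "W > 0" using s L by (simp add: W_def)
  obtain K0 where K0: "\<And>K. K \<ge> K0 \<Longrightarrow>
      ennreal (max (2 * (2 * R) ^ n) (4 / \<delta>)) \<le> emeasure (Rn_lborel n) (Rn_scale n K ` B)"
    using volume_scaled_body_unbounded[OF n B] by blast
  define K where "K = max k K0"
  define D where "D = Rn_scale n K ` B"
  have D: "compactin (Rn_topology n) D" unfolding D_def by (rule compactin_Rn_scale[OF B(2)])
  define v where "v = measure (Rn_lborel n) D"
  have vD: "emeasure (Rn_lborel n) D = ennreal v"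
    unfolding v_def using emeasure_compactin_Rn_finite[OF D] by (intro emeasure_eq_ennreal_measure) auto
  have vbig: "2 * (2 * R) ^ n \<le> v" "4 / \<delta> \<le> v"
  proof -
    have "ennreal (max (2 * (2 * R) ^ n) (4 / \<delta>)) \<le> ennreal v"
      using K0[of K] unfolding vD[symmetric] D_def K_def by simp
    then have "max (2 * (2 * R) ^ n) (4 / \<delta>) \<le> v"
      by (subst (asm) ennreal_le_iff) (auto simp: v_def)
    then show "2 * (2 * R) ^ n \<le> v" "4 / \<delta> \<le> v" by auto
  qed
  have v: "v > 0" using vbig(2) lam by (smt (verit) divide_pos_pos)
  define a where "a = measure (Rn_lborel n) (D - Q)"
  have Dm: "D \<in> sets (Rn_lborel n)" by (rule compactin_Rn_measurable[OF D])
  have Qm: "Q \<in> sets (Rn_lborel n)" unfolding Q_def by (rule box_measurable)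
  have mQ: "emeasure (Rn_lborel n) Q = ennreal ((2 * R) ^ n)"
    unfolding Q_def by (rule emeasure_box[OF R])
  have AD: "D - Q \<in> sets (Rn_lborel n)" using Dm Qm by auto
  have "emeasure (Rn_lborel n) (D - Q) \<le> emeasure (Rn_lborel n) D"
    by (intro emeasure_mono Dm) auto
  then have aA: "emeasure (Rn_lborel n) (D - Q) = ennreal a"
    unfolding a_def vD by (intro emeasure_eq_ennreal_measure) (auto simp: top_unique)
  have "emeasure (Rn_lborel n) D \<le> emeasure (Rn_lborel n) ((D - Q) \<union> Q)"
    using Dm Qm by (intro emeasure_mono) auto
  also have "\<dots> \<le> emeasure (Rn_lborel n) (D - Q) + emeasure (Rn_lborel n) Q"
    by (rule emeasure_subadditive[OF AD Qm])
  finally have "ennreal v \<le> ennreal (a + (2 * R) ^ n)"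
    unfolding aA mQ vD using R by (simp add: a_def)
  then have "v \<le> a + (2 * R) ^ n"
    using R by (subst (asm) ennreal_le_iff) (auto simp: a_def)
  then have av: "v / 2 \<le> a" using vbig(1) by simp
  have a: "a > 0" using av v by simp
  define M where "M = nat \<lfloor>\<delta> * a\<rfloor>"
  have la: "\<delta> * a \<ge> 2"
  proof -
    have "2 = \<delta> * (4 / \<delta> / 2)" using lam by simp
    also have "\<dots> \<le> \<delta> * a" using av vbig(2) lam by (intro mult_left_mono) auto
    finally show ?thesis .
  qed
  have M_le: "real M \<le> \<delta> * a" using la by (simp add: M_def)
  have M_ge: "real M \<ge> \<delta> * a / 2" using la unfolding M_def by linarith
  have M: "M > 0" using M_ge la by (cases M) auto
  obtain F where F: "finite F" "F \<subseteq> D - Q" "\<And>z. card {x\<in>F. Rn_dist n x z \<le> r} \<le> L - 1"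
    "real M \<le> real (L - 1) * real (card F)
      + 2 * (real M ^ L * (sqrt (pi / s) ^ (n * L) / a ^ (L - 1)))
        / (exp (- s * (L * r\<^sup>2)) * sqrt (pi / (s * L)) ^ n)"
    using finite_code_in_region[OF AD aA a L0 M s r] by blast
  have M_pow: "real M ^ L = real M * real M ^ (L - 1)" using L by (cases L) auto
  have "2 * (real M ^ L * (sqrt (pi / s) ^ (n * L) / a ^ (L - 1)))
        / (exp (- s * (L * r\<^sup>2)) * sqrt (pi / (s * L)) ^ n)
      = real M / 2 * (4 * W * (real M / a) ^ (L - 1))"
    by (simp add: W_def M_pow power_divide mult_ac)
  also have "\<dots> \<le> real M / 2 * (4 * W * \<delta> ^ (L - 1))"
    using M_le a W by (intro mult_left_mono power_mono) (auto simp: field_simps)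
  also have "\<dots> \<le> real M / 2 * 1"
    using sparse unfolding W_def by (intro mult_left_mono) auto
  finally have "real M / 2 \<le> real (L - 1) * real (card F)" using F(4) by linarith
  moreover have "\<delta> * v / 2 \<le> \<delta> * a" using mult_left_mono[OF av, of \<delta>] lam by simp
  ultimately have "\<delta> * v / 8 \<le> real (L - 1) * real (card F)" using M_ge by linarith
  then have "\<delta> / (8 * real (L - 1)) * v \<le> real (card F)" using L by (simp add: field_simps)
  then have "ennreal (\<delta> / (8 * real (L - 1)) * v) \<le> ennreal (real (card F))" by (rule ennreal_leI)
  then have c6: "ennreal (\<delta> / (8 * real (L - 1))) * emeasure (Rn_lborel n) D \<le> of_nat (card F)"
    unfolding vD ennreal_of_nat_eq_real_of_nat using lam v by (subst ennreal_mult[symmetric]) simp_all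
  have c4: "\<exists>i<n. \<bar>x i\<bar> > R" if "x \<in> F" for x
  proof (rule ccontr)
    assume *: "\<not> ?thesis"
    have "x \<in> D" "x \<notin> Q" using that F(2) by auto
    moreover have "D \<subseteq> Rn n" using compactin_subset_topspace[OF D] by (simp add: topspace_Rn_topology)
    ultimately have "x \<in> Rn n" "x \<notin> Q" by auto
    moreover have "- R \<le> x i \<and> x i \<le> R" if "i < n" for i
    proof -
      have "\<bar>x i\<bar> \<le> R" using * that not_less by blast
      then show ?thesis by linarith
    qed
    ultimately show False by (auto simp: Rn_def Q_def PiE_iff)
  qed
  have c7: "0 < emeasure (Rn_lborel n) D" unfolding vD using v by simp
  show ?thesis
    by (rule that[of K F, folded D_def, OF _ F(1) _ c4 F(3) c6 c7]) (use F(2) in \<open>auto simp: K_def\<close>)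
qed

lemma coordinate_le_Rn_dist: "i < n \<Longrightarrow> \<bar>x i - y i\<bar> \<le> Rn_dist n x y"
  unfolding Rn_dist_def
  using member_le_L2_set[of "{..<n}" i "\<lambda>i. \<bar>x i - y i\<bar>"] by (simp add: L2_set_def)

text \<open>The rate is an upper limit, so it is enough to have a good density at a sequence of scales.
  The finite codes at these scales are chosen one after the other, each outside a cube that contains
  all earlier ones with a margin of \<open>2 r\<close>. A ball of radius \<open>r\<close> then meets at most one of them, and
  the packing property of the union reduces to that of the pieces. The predicate \<open>good\<close> carries along
  what else is known about each piece.\<close>

lemma multiple_packing_of_finite_codes:
  fixes B :: "(nat \<Rightarrow> real) set" and good :: "real \<Rightarrow> (nat \<Rightarrow> real) set \<Rightarrow> bool"
  assumes B: "compactin (Rn_topology n) B" and N: "N \<ge> 0"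
    and step: "\<And>R k. R \<ge> 0 \<Longrightarrow> \<exists>K F. K \<ge> (k::real) \<and> finite F \<and> F \<subseteq> Rn_scale n K ` B \<and>
      (\<forall>x\<in>F. \<exists>i<n. \<bar>x i\<bar> > R) \<and> (\<forall>z. card {x\<in>F. Rn_dist n x z \<le> sqrt (real n * N)} \<le> M) \<and> good K F"
  obtains \<C> where "multiple_packing n N M \<C>"
    "\<And>k. \<exists>K F. K \<ge> k \<and> good K F \<and> finite F \<and> F \<subseteq> \<C> \<inter> Rn_scale n K ` B"
proof -
  define r where "r = sqrt (real n * N)"
  have r: "r \<ge> 0" using N by (simp add: r_def)
  define chunk where "chunk = (\<lambda>R k K F R'. R' \<ge> R \<and> K \<ge> k \<and> finite F \<and> F \<subseteq> Rn_scale n K ` B \<and>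
      (\<forall>x\<in>F. \<exists>i<n. \<bar>x i\<bar> > R + 2 * r) \<and> (\<forall>x\<in>F. \<forall>i<n. \<bar>x i\<bar> \<le> R') \<and>
      (\<forall>z. card {x\<in>F. Rn_dist n x z \<le> r} \<le> M) \<and> good K F)"
  have "\<exists>K F R'. chunk R k K F R'"
    if R: "R \<ge> 0" for R k
  proof -
    have "R + 2 * r \<ge> 0" using R r by simp
    from step[OF this, of k] obtain K F where KF: "K \<ge> k" "finite F" "F \<subseteq> Rn_scale n K ` B"
      "\<forall>x\<in>F. \<exists>i<n. \<bar>x i\<bar> > R + 2 * r" "\<forall>z. card {x\<in>F. Rn_dist n x z \<le> r} \<le> M" "good K F"
      unfolding r_def by blast
    obtain b where b: "b \<ge> 0" "\<And>x i. x \<in> Rn_scale n K ` B \<Longrightarrow> i < n \<Longrightarrow> \<bar>x i\<bar> \<le> b"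
      using compactin_Rn_bounded[OF compactin_Rn_scale[OF B]] by blast
    have "\<forall>x\<in>F. \<forall>i<n. \<bar>x i\<bar> \<le> max R b" using b(2) KF(3) by (auto simp: le_max_iff_disj)
    moreover have "max R b \<ge> R" by simp
    ultimately have "chunk R k K F (max R b)" unfolding chunk_def using KF by blast
    then show ?thesis by blast
  qed
  then obtain fK fF fR where f: "\<And>R k. R \<ge> 0 \<Longrightarrow> chunk R k (fK R k) (fF R k) (fR R k)"
    by metis
  define Rs where "Rs = rec_nat 0 (\<lambda>j R. fR R (real j))"
  have Rs_Suc: "Rs (Suc j) = fR (Rs j) (real j)" for j by (simp add: Rs_def)
  have Rs_nonneg: "Rs j \<ge> 0" for j
  proof (induction j)
    case 0 show ?case by (simp add: Rs_def)
  next
    case (Suc j) then show ?case using f[OF Suc, of "real j"] unfolding Rs_Suc chunk_def by linarith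
  qed
  define F where "F = (\<lambda>j. fF (Rs j) (real j))"
  define K where "K = (\<lambda>j. fK (Rs j) (real j))"
  have g: "Rs (Suc j) \<ge> Rs j" "K j \<ge> real j" "finite (F j)" "F j \<subseteq> Rn_scale n (K j) ` B"
     "\<forall>x\<in>F j. \<exists>i<n. \<bar>x i\<bar> > Rs j + 2 * r" "\<forall>x\<in>F j. \<forall>i<n. \<bar>x i\<bar> \<le> Rs (Suc j)"
     "\<And>z. card {x\<in>F j. Rn_dist n x z \<le> r} \<le> M" "good (K j) (F j)" for j
    using f[OF Rs_nonneg[of j], of "real j"] unfolding F_def K_def Rs_Suc chunk_def by blast+
  have mono: "Rs i \<le> Rs j" if "i \<le> j" for i j
    using that g(1) by (rule lift_Suc_mono_le[rotated])
  have far: False if "i < j" and "p \<in> F i" and "q \<in> F j" and near: "Rn_dist n p y \<le> r" "Rn_dist n q y \<le> r" for i j p q y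
  proof -
    obtain l where l: "l < n" "\<bar>q l\<bar> > Rs j + 2 * r" using g(5)[of j] \<open>q \<in> F j\<close> by blast
    have "\<bar>p l\<bar> \<le> Rs (Suc i)" using g(6)[of i] \<open>p \<in> F i\<close> l(1) by blast
    also have "\<dots> \<le> Rs j" using \<open>i < j\<close> by (intro mono) auto
    finally show False
      using l(2) coordinate_le_Rn_dist[OF l(1), of p y] coordinate_le_Rn_dist[OF l(1), of q y] near
      by linarith
  qed
  define \<C> where "\<C> = (\<Union>j. F j)"
  have "multiple_packing n N M \<C>"
    unfolding multiple_packing_def r_def[symmetric]
  proof (intro conjI ballI)
    have "F j \<subseteq> Rn n" for j
      using g(4)[of j] compactin_subset_topspace[OF compactin_Rn_scale[OF B, of "K j"]]
      by (simp add: topspace_Rn_topology)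
    then show "\<C> \<subseteq> Rn n" by (auto simp: \<C>_def)
    fix y
    have "\<exists>j. {x\<in>\<C>. Rn_dist n x y \<le> r} \<subseteq> {x\<in>F j. Rn_dist n x y \<le> r}"
    proof (cases "{x\<in>\<C>. Rn_dist n x y \<le> r} = {}")
      case False
      then obtain x j where x: "x \<in> F j" "Rn_dist n x y \<le> r" by (auto simp: \<C>_def)
      have "x' \<in> F j" if "x' \<in> F i" "Rn_dist n x' y \<le> r" for x' i
        using far[OF _ x(1) that(1) x(2) that(2)] far[OF _ that(1) x(1) that(2) x(2)] that
        by (cases i j rule: linorder_cases) auto
      then show ?thesis by (intro exI[of _ j]) (auto simp: \<C>_def)
    qed auto
    then obtain j where j: "{x\<in>\<C>. Rn_dist n x y \<le> r} \<subseteq> {x\<in>F j. Rn_dist n x y \<le> r}" ..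
    have fin: "finite {x\<in>F j. Rn_dist n x y \<le> r}" using g(3)[of j] by simp
    show "finite {x\<in>\<C>. Rn_dist n x y \<le> r}" by (rule finite_subset[OF j fin])
    show "card {x\<in>\<C>. Rn_dist n x y \<le> r} \<le> M"
      by (rule order_trans[OF card_mono[OF fin j] g(7)])
  qed
  moreover have "\<exists>K' F'. K' \<ge> k \<and> good K' F' \<and> finite F' \<and> F' \<subseteq> \<C> \<inter> Rn_scale n K' ` B" for k
  proof -
    obtain j where j: "k \<le> real j" using real_arch_simple by blast
    have "F j \<subseteq> \<C> \<inter> Rn_scale n (K j) ` B" using g(4)[of j] by (auto simp: \<C>_def)
    moreover have "k \<le> K j" using g(2)[of j] j by linarith
    ultimately show ?thesis using g(3)[of j] g(8)[of j] by blast
  qed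
  ultimately show ?thesis by (rule that)
qed

section \<open>The rate and the capacity\<close>

lemma eln_mono: "a \<le> b \<Longrightarrow> eln a \<le> eln b"
proof (cases "a = 0 \<or> b = \<infinity>")
  case True
  then show "a \<le> b \<Longrightarrow> eln a \<le> eln b" by (auto simp: eln_def top_unique)
next
  case False
  assume ab: "a \<le> b"
  have fin: "a \<noteq> \<infinity>" "b \<noteq> 0" using False ab by (auto simp: top_unique)
  have "0 < enn2real a" using False fin by (simp add: enn2real_positive_iff less_top zero_less_iff_neq_zero)
  moreover have "enn2real a \<le> enn2real b" using ab False by (intro enn2real_mono) (auto simp: less_top)
  ultimately show ?thesis using False fin by (simp add: eln_def)
qed

lemma rate_ge:
  assumes n: "n \<ge> 1" and B: "compactin (Rn_topology n) B" and c: "c > 0"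
    and dense: "\<And>k. \<exists>K F. K \<ge> (k::real) \<and> finite F \<and> F \<subseteq> \<C> \<inter> Rn_scale n K ` B \<and>
      0 < emeasure (Rn_lborel n) (Rn_scale n K ` B) \<and>
      ennreal c * emeasure (Rn_lborel n) (Rn_scale n K ` B) \<le> of_nat (card F)"
  shows "ereal (ln c / real n) \<le> rate n B \<C>"
  unfolding rate_def Limsup_def
proof (rule INF_greatest)
  fix P :: "real \<Rightarrow> bool" assume "P \<in> {P. eventually P at_top}"
  then obtain k where k: "\<And>K. K \<ge> k \<Longrightarrow> P K" by (auto simp: eventually_at_top_linorder)
  obtain K F where KF: "K \<ge> k" "finite F" "F \<subseteq> \<C> \<inter> Rn_scale n K ` B"
      "0 < emeasure (Rn_lborel n) (Rn_scale n K ` B)"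
      "ennreal c * emeasure (Rn_lborel n) (Rn_scale n K ` B) \<le> of_nat (card F)"
    using dense[of k] by blast
  define v where "v = emeasure (Rn_lborel n) (Rn_scale n K ` B)"
  have v: "v \<noteq> 0" "v \<noteq> \<infinity>"
    using KF(4) emeasure_compactin_Rn_finite[OF compactin_Rn_scale[OF B], of K] by (auto simp: v_def)
  have "of_nat (card F) = emeasure (count_space UNIV) F" using KF(2) by (simp add: emeasure_count_space)
  also have "\<dots> \<le> emeasure (count_space UNIV) (\<C> \<inter> Rn_scale n K ` B)"
    using KF(3) by (intro emeasure_mono) auto
  finally have "ennreal c * v \<le> emeasure (count_space UNIV) (\<C> \<inter> Rn_scale n K ` B)"
    using KF(5) unfolding v_def by (rule order_trans[rotated])
  then have "ennreal c * v / v \<le> emeasure (count_space UNIV) (\<C> \<inter> Rn_scale n K ` B) / v"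
    by (rule divide_right_mono_ennreal)
  also have "ennreal c * v / v = ennreal c"
    using v by (simp add: ennreal_mult_divide_eq)
  finally have "eln (ennreal c) \<le> eln (emeasure (count_space UNIV) (\<C> \<inter> Rn_scale n K ` B) / v)"
    by (rule eln_mono)
  moreover have "eln (ennreal c) = ereal (ln c)" using c by (simp add: eln_def)
  ultimately have "ereal (1 / real n) * ereal (ln c)
      \<le> ereal (1 / real n) * eln (emeasure (count_space UNIV) (\<C> \<inter> Rn_scale n K ` B) / v)"
    by (intro ereal_mult_left_mono) auto
  then show "ereal (ln c / real n) \<le> (SUP K\<in>Collect P. ereal (1 / real n) *
      eln (emeasure (count_space UNIV) (\<C> \<inter> Rn_scale n K ` B) / emeasure (Rn_lborel n) (Rn_scale n K ` B)))"
    unfolding v_def using k[OF KF(1)] by (intro SUP_upper2[of K]) auto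
qed

text \<open>With \<open>r\<^sup>2 = n N\<close> the ratio of the two energy bounds is \<open>w ^ n\<close> for a \<open>w\<close> independent of \<open>n\<close>. The
  choice \<open>s = (L - 1) / (2 N L)\<close> minimises \<open>w\<close>, and then \<open>- ln w / (L - 1)\<close> is precisely the claimed
  bound \<open>v\<close>. All constants that are independent of \<open>n\<close> only enter the error term of order \<open>1 / n\<close>.\<close>

lemma multiple_packing_rate_ge:
  fixes N :: real and L n :: nat
  defines "v \<equiv> 1 / 2 * ln ((real L - 1) / (2 * pi * exp 1 * N * real L)) - ln (real L) / (2 * (real L - 1))"
  assumes n: "n \<ge> 1" and B: "admissible_body n B" and N: "N > 0" and L: "L \<ge> 2"
  obtains \<C> where "multiple_packing n N (L - 1) \<C>"
    "ereal (v - (ln 4 / real (L - 1) + ln (8 * real (L - 1))) / real n) \<le> rate n B \<C>"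
proof -
  have Bc: "compactin (Rn_topology n) B" and Bi: "Rn_topology n interior_of B \<noteq> {}"
    using B by (auto simp: admissible_body_def)
  define m where "m = real (L - 1)"
  have m: "m > 0" "real L - 1 = m" using L by (auto simp: m_def)
  define s where "s = m / (2 * N * L)"
  have s: "s > 0" using m N L by (simp add: s_def)
  define r where "r = sqrt (real n * N)"
  have r: "r \<ge> 0" "r\<^sup>2 = real n * N" using N by (auto simp: r_def)
  define w where "w = exp (s * (L * N)) * sqrt (pi / s) ^ L / sqrt (pi / (s * L))"
  have w: "w > 0" using s L by (simp add: w_def)
  have wn: "sqrt (pi / s) ^ (n * L) / (exp (- s * (L * r\<^sup>2)) * sqrt (pi / (s * L)) ^ n) = w ^ n"
  proof -
    have "exp (- s * (L * r\<^sup>2)) = inverse (exp (s * (L * N)) ^ n)"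
      by (simp add: r(2) exp_minus algebra_simps flip: exp_of_nat_mult)
    moreover have "sqrt (pi / s) ^ (n * L) = (sqrt (pi / s) ^ L) ^ n"
      by (simp add: mult.commute flip: power_mult)
    ultimately show ?thesis
      by (simp add: w_def power_mult_distrib power_divide divide_inverse power_inverse)
  qed
  \<comment> \<open>The density for which the sparsity condition of the finite codes holds with equality.\<close>
  define \<delta> where "\<delta> = (4 * w ^ n) powr (- 1 / m)"
  have del: "\<delta> > 0" using w by (simp add: \<delta>_def)
  have ln_del: "ln \<delta> = - (ln 4 + n * ln w) / m"
  proof -
    have "ln \<delta> = - 1 / m * ln (4 * w ^ n)" using w by (simp add: \<delta>_def ln_powr)
    also have "ln (4 * w ^ n) = ln 4 + n * ln w" using w by (simp add: ln_mult ln_realpow)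
    finally show ?thesis using m(1) by (simp add: field_simps)
  qed
  have "\<delta> ^ (L - 1) = \<delta> powr m" using del by (simp add: m_def powr_realpow)
  also have "\<dots> = (4 * w ^ n) powr (- 1)" using m by (simp add: \<delta>_def powr_powr)
  also have "\<dots> = 1 / (4 * w ^ n)" using w by (simp add: powr_minus_divide)
  finally have sparse: "4 * (sqrt (pi / s) ^ (n * L)
      / (exp (- s * (L * r\<^sup>2)) * sqrt (pi / (s * L)) ^ n)) * \<delta> ^ (L - 1) \<le> 1"
    unfolding wn using w by simp
  define c where "c = \<delta> / (8 * m)"
  have c: "c > 0" using del m by (simp add: c_def)
  define good where "good = (\<lambda>K (F :: (nat \<Rightarrow> real) set). ennreal c * emeasure (Rn_lborel n) (Rn_scale n K ` B) \<le> of_nat (card F)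
      \<and> 0 < emeasure (Rn_lborel n) (Rn_scale n K ` B))"
  have step: "\<exists>K F. K \<ge> (k::real) \<and> finite F \<and> F \<subseteq> Rn_scale n K ` B \<and>
      (\<forall>x\<in>F. \<exists>i<n. \<bar>x i\<bar> > R) \<and> (\<forall>z. card {x\<in>F. Rn_dist n x z \<le> sqrt (real n * N)} \<le> L - 1) \<and> good K F"
    if R: "R \<ge> 0" for R k
  proof (rule finite_code_far_out[OF n Bi Bc L s r(1) R del sparse, of k])
    fix K F
    assume KF: "k \<le> K" "finite F" "F \<subseteq> Rn_scale n K ` B" "\<And>x. x \<in> F \<Longrightarrow> \<exists>i<n. R < \<bar>x i\<bar>"
      "\<And>z. card {x \<in> F. Rn_dist n x z \<le> r} \<le> L - 1"
      "ennreal (\<delta> / (8 * real (L - 1))) * emeasure (Rn_lborel n) (Rn_scale n K ` B) \<le> of_nat (card F)"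
      "0 < emeasure (Rn_lborel n) (Rn_scale n K ` B)"
    have "good K F" using KF(6,7) unfolding good_def c_def m_def by (rule conjI)
    moreover have "\<forall>x\<in>F. \<exists>i<n. R < \<bar>x i\<bar>" by (rule ballI) (rule KF(4))
    moreover have "\<forall>z. card {x \<in> F. Rn_dist n x z \<le> sqrt (real n * N)} \<le> L - 1"
      using KF(5) unfolding r_def by (rule allI)
    ultimately show ?thesis using KF(1-3) by (intro exI[of _ K] exI[of _ F] conjI)
  qed
  obtain \<C> where \<C>: "multiple_packing n N (L - 1) \<C>"
    "\<And>k. \<exists>K F. K \<ge> k \<and> good K F \<and> finite F \<and> F \<subseteq> \<C> \<inter> Rn_scale n K ` B"
    using multiple_packing_of_finite_codes[OF Bc less_imp_le[OF N] step] by blast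
  have "ereal (ln c / real n) \<le> rate n B \<C>"
  proof (rule rate_ge[OF n Bc c])
    fix k :: real
    show "\<exists>K F. K \<ge> k \<and> finite F \<and> F \<subseteq> \<C> \<inter> Rn_scale n K ` B \<and>
      0 < emeasure (Rn_lborel n) (Rn_scale n K ` B) \<and>
      ennreal c * emeasure (Rn_lborel n) (Rn_scale n K ` B) \<le> of_nat (card F)"
      using \<C>(2)[of k] unfolding good_def by blast
  qed
  moreover have "ln c / real n = v - (ln 4 / m + ln (8 * m)) / real n"
  proof -
    have ln_sqrts: "ln (sqrt (pi / s)) = (ln pi - ln s) / 2" 
      "ln (sqrt (pi / (s * L))) = (ln pi - ln s - ln L) / 2"
      using s L by (simp_all add: ln_sqrt ln_div ln_mult)
    have "ln w = s * (L * N) + L * ln (sqrt (pi / s)) - ln (sqrt (pi / (s * L)))"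
      using s L by (simp add: w_def ln_mult ln_div ln_realpow)
    also have "s * (L * N) = m / 2" using N L by (simp add: s_def)
    also have "m / 2 + L * ln (sqrt (pi / s)) - ln (sqrt (pi / (s * L)))
        = (m + m * (ln pi - ln s) + ln L) / 2"
      unfolding ln_sqrts m(2)[symmetric] by (simp add: field_simps)
    finally have lnw: "ln w = (m + m * (ln pi - ln s) + ln L) / 2" .
    have lns: "ln s = ln m - ln 2 - ln N - ln L"
      using m N L by (simp add: s_def ln_div ln_mult)
    have "v = 1 / 2 * (ln m - ln 2 - ln pi - 1 - ln N - ln L) - ln L / (2 * m)"
      unfolding v_def m(2) using m(1) N L by (simp add: ln_div ln_mult)
    then have v_eq: "v = - ln w / m"
      unfolding lnw lns using m(1) by (simp add: field_simps)
    have ln_c: "ln c = - (ln 4 + n * ln w) / m - ln (8 * m)"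
      using del m(1) unfolding c_def by (simp add: ln_div ln_del)
    show ?thesis unfolding v_eq ln_c using n m(1) by (simp add: field_simps)
  qed
  ultimately show ?thesis using that \<C>(1) unfolding m_def by metis
qed

theorem mainTheorem2:
  fixes N :: real and L :: nat and B :: "nat \<Rightarrow> (nat \<Rightarrow> real) set"
  assumes "N > 0" and "L \<ge> 2"
    and "\<And>n. n \<ge> 1 \<Longrightarrow> admissible_body n (B n)"
  shows "list_decoding_capacity B (L - 1) N \<ge>
    ereal (1 / 2 * ln ((real L - 1) / (2 * pi * exp 1 * N * real L)) - ln (real L) / (2 * (real L - 1)))"
proof -
  define v where "v = 1 / 2 * ln ((real L - 1) / (2 * pi * exp 1 * N * real L)) - ln (real L) / (2 * (real L - 1))"
  define \<kappa> where "\<kappa> = ln 4 / real (L - 1) + ln (8 * real (L - 1))"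
  have ge: "ereal (v - \<kappa> / real n) \<le> (SUP \<C>\<in>{\<C>. multiple_packing n N (L - 1) \<C>}. rate n (B n) \<C>)"
    if n: "n \<ge> 1" for n
  proof -
    obtain \<C> where \<C>: "multiple_packing n N (L - 1) \<C>" "ereal (v - \<kappa> / real n) \<le> rate n (B n) \<C>"
      using multiple_packing_rate_ge[OF n assms(3)[OF n] assms(1,2)] unfolding v_def \<kappa>_def by blast
    then show ?thesis by (intro SUP_upper2[of \<C>]) auto
  qed
  have "(\<lambda>n. v - \<kappa> / real n) \<longlonglongrightarrow> v - 0"
    by (intro tendsto_diff tendsto_const lim_const_over_n)
  then have "(\<lambda>n. ereal (v - \<kappa> / real n)) \<longlonglongrightarrow> ereal v" by simp
  then have "ereal v = limsup (\<lambda>n. ereal (v - \<kappa> / real n))"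
    by (intro lim_imp_Limsup[symmetric]) auto
  also have "\<dots> \<le> list_decoding_capacity B (L - 1) N"
    unfolding list_decoding_capacity_def
    by (rule Limsup_mono) (use ge in \<open>auto simp: eventually_sequentially\<close>)
  finally show ?thesis unfolding v_def .
qed

end
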